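(* Let $\Gamma$ be a circle in the Euclidean plane with center $O$ and radius $R>0$, and let $\ell$ be the tangent line to $\Gamma$ at a point $V\in\Gamma$. Then the metric bisector of the horn angle formed by $\Gamma$ and $\ell$ is the parabola with focus $O$, focal distance $R$, and directrix parallel to $\ell$, with vertex at $V$. That is, the set of points $B$ of the horn angle region between $\Gamma$ and $\ell$ such that $\operatorname{dist}(B,\ell)=\operatorname{dist}(B,\Gamma)$ is exactly this parabola.
   Context: The horn angle formed by a circle $\Gamma$ (center $O$, radius $R$) and its tangent line $\ell$ at $V$ is the curvilinear angle with vertex $V$ and sides $\Gamma$ and $\ell$. The horn angle region between $\Gamma$ and $\ell$ is the set of points $B$ that lie in the closed half-plane bounded by $\ell$ containing $O$ and satisfy $|OB|\ge R$ (points on or outside $\Gamma$). The metric bisector of a curvilinear angle is the curve each point of which is equidistant from both sides of the angle, i.e. the locus of points in the angle equidistant from its two sides. The distance from a point to a line or a circle is the infimum of distances to its points. A parabola is the locus of points equidistant from a given point (focus) and a given line (directrix) not containing it; its vertex is the midpoint of the perpendicular from the focus to the directrix, and its focal distance is the distance from the focus to the vertex. *)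

theory Defs
  imports "HOL-Analysis.Analysis"
begin

type_synonym point = "real ^ 2"

definition is_line :: "point set \<Rightarrow> bool" where
  "is_line l \<longleftrightarrow> affine l \<and> aff_dim l = 1"

definition tangent_line_at :: "point set \<Rightarrow> point set \<Rightarrow> point \<Rightarrow> bool" where
  "tangent_line_at l \<Gamma> V \<longleftrightarrow> is_line l \<and> l \<inter> \<Gamma> = {V}"

definition closed_half_plane :: "point set \<Rightarrow> point set \<Rightarrow> bool" where
  "closed_half_plane H l \<longleftrightarrow>
     (\<exists>a b. a \<noteq> 0 \<and> l = {x. a \<bullet> x = b} \<and> H = {x. a \<bullet> x \<le> b})"

(* For a line l not through c, exactly one of its two closed half-planes contains c. *)
definition horn_region :: "point \<Rightarrow> real \<Rightarrow> point set \<Rightarrow> point set" where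
  "horn_region c R l =
     {B. (\<exists>H. closed_half_plane H l \<and> c \<in> H \<and> B \<in> H) \<and> dist c B \<ge> R}"

definition metric_bisector :: "point set \<Rightarrow> point set \<Rightarrow> point set \<Rightarrow> point set" where
  "metric_bisector A s t = {B \<in> A. infdist B s = infdist B t}"

definition parabola :: "point \<Rightarrow> point set \<Rightarrow> point set" where
  "parabola F d = {B. dist B F = infdist B d}"

definition perpendicular_foot :: "point \<Rightarrow> point set \<Rightarrow> point" where
  "perpendicular_foot F d = (THE p. p \<in> d \<and> (\<forall>q\<in>d. orthogonal (F - p) (q - p)))"

definition parabola_vertex :: "point \<Rightarrow> point set \<Rightarrow> point" where
  "parabola_vertex F d = midpoint F (perpendicular_foot F d)"

definition focal_distance :: "point \<Rightarrow> point set \<Rightarrow> real" where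
  "focal_distance F d = dist F (parabola_vertex F d)"

(* d is an admissible directrix for the focus F (a line not containing F), and the
   resulting parabola has vertex V, focal distance f and directrix parallel to l. *)
definition directrix_for :: "point \<Rightarrow> real \<Rightarrow> point \<Rightarrow> point set \<Rightarrow> point set \<Rightarrow> bool" where
  "directrix_for F f V l d \<longleftrightarrow>
     is_line d \<and> F \<notin> d \<and> affine_parallel d l \<and>
     parabola_vertex F d = V \<and> focal_distance F d = f"

end

theory Submission imports Defs begin

text \<open>Put \<open>n = V - c\<close> and \<open>u = B - c\<close>. Tangency forces \<open>n\<close> to be normal to \<open>l\<close>, so \<open>l\<close> and
  the only possible directrix are \<open>n \<bullet> u = R\<^sup>2\<close> and \<open>n \<bullet> u = 2 * R\<^sup>2\<close>. In the horn region the
  bisector equation is \<open>(R\<^sup>2 - n \<bullet> u) / R = norm u - R\<close>; adding \<open>R\<close> to both sides turns it into the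
  equation of the parabola.\<close>

section \<open>Distances to a hyperplane and to a sphere\<close>

lemma infdist_eqI:
  assumes "p \<in> A" and "dist x p = r" and "\<And>y. y \<in> A \<Longrightarrow> r \<le> dist x y"
  shows "infdist x A = r"
proof (rule antisym)
  show "infdist x A \<le> r"
    using infdist_le[OF assms(1), of x] assms(2) by simp
  have "A \<noteq> {}" using assms(1) by blast
  then show "r \<le> infdist x A"
    unfolding infdist_notempty[OF \<open>A \<noteq> {}\<close>] by (intro cINF_greatest assms(3))
qed

text \<open>Removing the excess normal component of \<open>x\<close> gives its foot on the
  hyperplane; Cauchy-Schwarz shows that no other point is closer.\<close>

lemma infdist_hyperplane:
  fixes a x :: "'a::real_inner"
  assumes "a \<noteq> 0"
  shows "infdist x {y. a \<bullet> y = b} = \<bar>a \<bullet> x - b\<bar> / norm a"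
proof (rule infdist_eqI)
  let ?p = "x - ((a \<bullet> x - b) / (a \<bullet> a)) *\<^sub>R a"
  show "?p \<in> {y. a \<bullet> y = b}"
    using assms by (simp add: inner_diff_right)
  show "dist x ?p = \<bar>a \<bullet> x - b\<bar> / norm a"
    using assms by (simp add: dist_norm dot_square_norm power2_eq_square)
next
  fix y assume "y \<in> {y. a \<bullet> y = b}"
  then have "\<bar>a \<bullet> x - b\<bar> = \<bar>a \<bullet> (x - y)\<bar>"
    by (simp add: inner_diff_right)
  also have "\<dots> \<le> norm a * dist x y"
    unfolding dist_norm by (rule Cauchy_Schwarz_ineq2)
  finally show "\<bar>a \<bullet> x - b\<bar> / norm a \<le> dist x y"
    using assms by (simp add: divide_le_eq mult.commute)
qed

text \<open>The radial projection of \<open>x\<close> from \<open>c\<close> attains the distance,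
  and the triangle inequality is the lower bound.\<close>

lemma infdist_sphere_outside:
  fixes c x :: "'a::real_normed_vector"
  assumes "0 < r" and "r \<le> dist c x"
  shows "infdist x (sphere c r) = dist c x - r"
proof (rule infdist_eqI)
  let ?p = "c + (r / dist c x) *\<^sub>R (x - c)"
  have pos: "0 < dist c x" using assms by linarith
  then have "norm (x - c) \<noteq> 0" by (simp add: dist_norm norm_minus_commute)
  then show "?p \<in> sphere c r"
    using assms by (simp add: dist_norm norm_minus_commute)
  have "x - ?p = (1 - r / dist c x) *\<^sub>R (x - c)"
    by (simp add: algebra_simps)
  then have "dist x ?p = \<bar>1 - r / dist c x\<bar> * dist c x"
    by (simp add: dist_norm norm_minus_commute)
  also have "\<dots> = dist c x - r"
    using pos assms by (simp add: field_simps)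
  finally show "dist x ?p = dist c x - r" .
next
  fix y assume "y \<in> sphere c r"
  then show "dist c x - r \<le> dist x y"
    using dist_triangle[of c x y] by (simp add: dist_commute)
qed

section \<open>Lines as hyperplanes, and the normal at a point of tangency\<close>

lemma is_line_iff_hyperplane:
  "is_line l \<longleftrightarrow> (\<exists>a b. a \<noteq> 0 \<and> l = {x. a \<bullet> x = b})"
proof
  assume "is_line l"
  then show "\<exists>a b. a \<noteq> 0 \<and> l = {x. a \<bullet> x = b}"
    using aff_dim_eq_hyperplane[of l] by (simp add: is_line_def affine_hull_eq[THEN iffD2])
next
  assume "\<exists>a b. a \<noteq> 0 \<and> l = {x. a \<bullet> x = b}"
  then show "is_line l"
    by (auto simp: is_line_def affine_hyperplane aff_dim_hyperplane)
qed

text \<open>The mirror image of the contact point in the diameter orthogonal to the hyperplane lies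
  on both the hyperplane and the sphere, so it is the contact point itself.\<close>

lemma radius_parallel_normal_of_tangent_hyperplane:
  fixes a c v :: "'a::real_inner"
  assumes "a \<noteq> 0" and "{x. a \<bullet> x = b} \<inter> sphere c r = {v}"
  obtains k where "v - c = k *\<^sub>R a"
proof -
  \<comment> \<open>\<open>c + k *\<^sub>R a\<close> is the foot of the perpendicular from
    \<open>c\<close>, and \<open>w\<close> is the reflection of \<open>v\<close> in that
    foot.\<close>
  define k where "k = (b - a \<bullet> c) / (a \<bullet> a)"
  define w where "w = 2 *\<^sub>R (c + k *\<^sub>R a) - v"
  have v: "a \<bullet> v = b" "norm (v - c) = r"
    using assms(2) by (auto simp: set_eq_iff dist_norm norm_minus_commute)
  have k: "k * (a \<bullet> a) = a \<bullet> (v - c)"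
    using v assms(1) by (simp add: k_def inner_diff_right)
  have w: "a \<bullet> w = b"
    using v k by (simp add: w_def inner_diff_right inner_add_right)
  \<comment> \<open>A general \<open>u\<close> keeps \<open>v - c\<close> from being split, and
    \<open>k * (a \<bullet> a)\<close> stays one factor so that the fact \<open>k\<close> cancels
    the two middle terms.\<close>
  have norm_reflect: "(norm (2 *\<^sub>R k *\<^sub>R a - u))\<^sup>2 =
      4 * k * (k * (a \<bullet> a)) - 4 * k * (a \<bullet> u) + (norm u)\<^sup>2" for u
    unfolding power2_norm_eq_inner by (simp add: inner_diff_left inner_diff_right inner_commute)
  have "w - c = 2 *\<^sub>R k *\<^sub>R a - (v - c)"
    by (simp add: w_def scaleR_add_right scaleR_2)
  then have "(norm (w - c))\<^sup>2 = (norm (2 *\<^sub>R k *\<^sub>R a - (v - c)))\<^sup>2"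
    by simp
  also have "\<dots> = 4 * k * (k * (a \<bullet> a)) - 4 * k * (a \<bullet> (v - c)) + (norm (v - c))\<^sup>2"
    by (rule norm_reflect)
  also have "\<dots> = (norm (v - c))\<^sup>2"
    unfolding k by simp
  finally have "norm (w - c) = r"
    using v by (metis norm_ge_zero power2_eq_imp_eq)
  with w have "w \<in> {x. a \<bullet> x = b} \<inter> sphere c r"
    by (simp add: dist_norm norm_minus_commute)
  then have "w = v" unfolding assms(2) by simp
  then have "2 *\<^sub>R (v - c) = 2 *\<^sub>R (k *\<^sub>R a)"
    by (simp add: w_def algebra_simps scaleR_2)
  then have "v - c = k *\<^sub>R a" by (simp only: scaleR_cancel_left) simp
  then show ?thesis by (rule that)
qed

section \<open>Parallel hyperplanes, perpendicular feet and the directrix\<close>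

lemma affine_parallel_hyperplane_iff:
  fixes a :: "'a::real_inner"
  assumes "a \<noteq> 0"
  shows "affine_parallel d {x. a \<bullet> x = b} \<longleftrightarrow> (\<exists>b'. d = {x. a \<bullet> x = b'})"
proof
  assume "affine_parallel d {x. a \<bullet> x = b}"
  then obtain t where t: "{x. a \<bullet> x = b} = (\<lambda>x. t + x) ` d"
    by (auto simp: affine_parallel_def)
  have "x \<in> d \<longleftrightarrow> a \<bullet> x = b - a \<bullet> t" for x
  proof -
    have "x \<in> d \<longleftrightarrow> t + x \<in> (\<lambda>x. t + x) ` d"
      by (simp add: inj_image_mem_iff)
    also have "\<dots> \<longleftrightarrow> a \<bullet> x = b - a \<bullet> t"
      unfolding t[symmetric] by (auto simp: inner_add_right)
    finally show ?thesis .
  qed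
  then have "d = {x. a \<bullet> x = b - a \<bullet> t}" by blast
  then show "\<exists>b'. d = {x. a \<bullet> x = b'}" ..
next
  assume "\<exists>b'. d = {x. a \<bullet> x = b'}"
  then obtain b' where d: "d = {x. a \<bullet> x = b'}" ..
  \<comment> \<open>A shift along the normal that raises the level from \<open>b'\<close> to
    \<open>b\<close>.\<close>
  let ?t = "((b - b') / (a \<bullet> a)) *\<^sub>R a"
  have t: "a \<bullet> ?t = b - b'" using assms by simp
  have "{x. a \<bullet> x = b} = (\<lambda>x. ?t + x) ` d"
  proof (intro equalityI subsetI)
    fix x assume "x \<in> {x. a \<bullet> x = b}"
    then have "x - ?t \<in> d" using t unfolding d by (simp add: inner_diff_right del: inner_scaleR_right)
    then show "x \<in> (\<lambda>x. ?t + x) ` d" by (rule rev_image_eqI) simp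
  next
    fix x assume "x \<in> (\<lambda>x. ?t + x) ` d"
    then show "x \<in> {x. a \<bullet> x = b}"
      using t unfolding d by (auto simp: inner_add_right simp del: inner_scaleR_right)
  qed
  then show "affine_parallel d {x. a \<bullet> x = b}"
    by (auto simp: affine_parallel_def)
qed

lemma perpendicular_foot_hyperplane:
  assumes "a \<noteq> 0"
  shows "perpendicular_foot c {x. a \<bullet> x = b} = c + ((b - a \<bullet> c) / (a \<bullet> a)) *\<^sub>R a"
    (is "_ = ?p")
  unfolding perpendicular_foot_def
proof (rule the_equality)
  have p: "a \<bullet> ?p = b" using assms by (simp add: inner_add_right)
  then show "?p \<in> {x. a \<bullet> x = b} \<and> (\<forall>q\<in>{x. a \<bullet> x = b}. orthogonal (c - ?p) (q - ?p))"
    by (auto simp: orthogonal_def inner_diff_right)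
  fix q
  assume q: "q \<in> {x. a \<bullet> x = b} \<and> (\<forall>y\<in>{x. a \<bullet> x = b}. orthogonal (c - q) (y - q))"
  then have "orthogonal (c - q) (?p - q)" using p by blast
  moreover have "a \<bullet> (?p - q) = 0" using p q by (simp add: inner_diff_right)
  then have "(?p - c) \<bullet> (?p - q) = 0" by simp
  \<comment> \<open>\<open>?p - c\<close> is a multiple of \<open>a\<close> and \<open>c - q\<close>
    is orthogonal by the choice of \<open>q\<close>, so \<open>?p - q\<close> is orthogonal to
    itself.\<close>
  moreover have "(?p - q) \<bullet> (?p - q) = (?p - c) \<bullet> (?p - q) + (c - q) \<bullet> (?p - q)"
    by (simp only: inner_add_left[symmetric] add_diff_eq diff_add_cancel)
  ultimately have "(?p - q) \<bullet> (?p - q) = 0"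
    by (simp add: orthogonal_def)
  then show "q = ?p" by simp
qed

text \<open>With \<open>n = V - c\<close>, the vertex \<open>c + n\<close> is the midpoint of
  \<open>c\<close> and the foot exactly when the foot is \<open>c + 2n\<close>, at level
  \<open>2 * R\<^sup>2\<close> above \<open>c\<close>. The focal distance is then
  \<open>norm n = R\<close>.\<close>

lemma directrix_for_tangent_hyperplane_iff:
  fixes c V :: point
  assumes "R > 0" and "norm (V - c) = R"
  shows "directrix_for c R V {x. (V - c) \<bullet> x = (V - c) \<bullet> V} d \<longleftrightarrow>
    d = {x. (V - c) \<bullet> x = (V - c) \<bullet> c + 2 * R\<^sup>2}"
proof -
  define n where "n = V - c"
  have n: "n \<noteq> 0" "n \<bullet> n = R\<^sup>2" "V = c + n"
    using assms by (auto simp: n_def dot_square_norm)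
  have vertex: "parabola_vertex c {x. n \<bullet> x = b} = V \<longleftrightarrow> b = n \<bullet> c + 2 * R\<^sup>2" for b
  proof -
    have "parabola_vertex c {x. n \<bullet> x = b} = c + ((b - n \<bullet> c) / (2 * R\<^sup>2)) *\<^sub>R n"
      unfolding parabola_vertex_def perpendicular_foot_hyperplane[OF n(1)] n(2) midpoint_def
      by (simp add: scaleR_add_right add.assoc[symmetric] scaleR_left_distrib[symmetric])
    also have "\<dots> = V \<longleftrightarrow> ((b - n \<bullet> c) / (2 * R\<^sup>2)) *\<^sub>R n = 1 *\<^sub>R n"
      unfolding n(3) by simp
    also have "\<dots> \<longleftrightarrow> (b - n \<bullet> c) / (2 * R\<^sup>2) = 1"
      using n(1) by (simp only: scaleR_cancel_right) simp
    also have "\<dots> \<longleftrightarrow> b = n \<bullet> c + 2 * R\<^sup>2"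
      using assms(1) by (auto simp: field_simps)
    finally show ?thesis .
  qed
  have "directrix_for c R V {x. n \<bullet> x = n \<bullet> V} d \<longleftrightarrow> d = {x. n \<bullet> x = n \<bullet> c + 2 * R\<^sup>2}"
  proof
    assume D: "directrix_for c R V {x. n \<bullet> x = n \<bullet> V} d"
    then obtain b where "d = {x. n \<bullet> x = b}"
      unfolding directrix_for_def affine_parallel_hyperplane_iff[OF n(1)] by blast
    with D vertex show "d = {x. n \<bullet> x = n \<bullet> c + 2 * R\<^sup>2}"
      by (simp add: directrix_for_def)
  next
    assume d: "d = {x. n \<bullet> x = n \<bullet> c + 2 * R\<^sup>2}"
    then have "parabola_vertex c d = V" using vertex by simp
    then show "directrix_for c R V {x. n \<bullet> x = n \<bullet> V} d"
      unfolding directrix_for_def affine_parallel_hyperplane_iff[OF n(1)] is_line_iff_hyperplane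
        focal_distance_def
      using d n(1) assms by (auto simp: dist_norm norm_minus_commute)
  qed
  then show ?thesis by (simp only: n_def)
qed

section \<open>Tangent line, horn region and bisector of the circle\<close>

lemma tangent_line_eq_hyperplane:
  assumes "R > 0" and "tangent_line_at l (sphere c R) V"
  shows "l = {x. (V - c) \<bullet> x = (V - c) \<bullet> V}"
proof -
  obtain a b where a: "a \<noteq> 0" and l: "l = {x. a \<bullet> x = b}"
    and tangent: "l \<inter> sphere c R = {V}"
    using assms(2) by (auto simp: tangent_line_at_def is_line_iff_hyperplane)
  obtain k where k: "V - c = k *\<^sub>R a"
    using radius_parallel_normal_of_tangent_hyperplane[OF a] tangent l by metis
  have V: "a \<bullet> V = b" "V \<in> sphere c R" using tangent l by (auto simp: set_eq_iff)
  \<comment> \<open>\<open>k = 0\<close> would give \<open>V = c\<close>, which is not on a circle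
    of positive radius; a nonzero factor does not change the line.\<close>
  with assms(1) k have "k \<noteq> 0" by (auto simp: dist_norm)
  then show ?thesis unfolding k l using V by simp
qed

text \<open>Any \<open>a\<close> defining a half-plane that contains \<open>c\<close> satisfies
  \<open>V - c = k *\<^sub>R a\<close> with \<open>k \<ge> 0\<close>, so its inequality scales to
  the one for \<open>V - c\<close>.\<close>

lemma horn_region_eq:
  assumes "R > 0" and "tangent_line_at l (sphere c R) V"
  shows "horn_region c R l = {B. (V - c) \<bullet> B \<le> (V - c) \<bullet> V \<and> R \<le> dist c B}"
proof -
  let ?n = "V - c"
  have tangent: "l \<inter> sphere c R = {V}" using assms(2) by (simp add: tangent_line_at_def)
  then have V: "V \<in> l" "V \<in> sphere c R" by auto
  then have n: "?n \<noteq> 0" using assms(1) by auto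
  have "(\<exists>H. closed_half_plane H l \<and> c \<in> H \<and> B \<in> H) \<longleftrightarrow> ?n \<bullet> B \<le> ?n \<bullet> V" for B
  proof
    assume "\<exists>H. closed_half_plane H l \<and> c \<in> H \<and> B \<in> H"
    then obtain a b where a: "a \<noteq> 0" and l: "l = {x. a \<bullet> x = b}"
      and H: "a \<bullet> c \<le> b" "a \<bullet> B \<le> b"
      by (auto simp: closed_half_plane_def)
    obtain k where k: "?n = k *\<^sub>R a"
      using radius_parallel_normal_of_tangent_hyperplane[OF a] tangent l by metis
    have b: "b = a \<bullet> V" using V(1) l by simp
    have "k * (a \<bullet> a) = a \<bullet> ?n" unfolding k by simp
    also have "\<dots> \<ge> 0" using H(1) b by (simp add: inner_diff_right)
    finally have "0 \<le> k" using a by (simp add: zero_le_mult_iff) (metis inner_gt_zero_iff not_less)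
    then show "?n \<bullet> B \<le> ?n \<bullet> V"
      unfolding k using H(2) b by (simp add: mult_left_mono)
  next
    assume "?n \<bullet> B \<le> ?n \<bullet> V"
    \<comment> \<open>The difference of the two sides is \<open>?n \<bullet> ?n\<close>.\<close>
    moreover have "?n \<bullet> c \<le> ?n \<bullet> V"
      using inner_ge_zero[of ?n] by (simp only: inner_diff_right)
    moreover have "closed_half_plane {x. ?n \<bullet> x \<le> ?n \<bullet> V} l"
      unfolding closed_half_plane_def using n tangent_line_eq_hyperplane[OF assms] by blast
    ultimately show "\<exists>H. closed_half_plane H l \<and> c \<in> H \<and> B \<in> H" by blast
  qed
  then show ?thesis by (simp add: horn_region_def)
qed

text \<open>With \<open>s\<close> for \<open>(V - c) \<bullet> (B - c)\<close> and \<open>t\<close> for the distance from \<open>c\<close> to \<open>B\<close>, both sides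
  say \<open>R * t = 2 * R\<^sup>2 - s\<close>; by the Cauchy--Schwarz bound \<open>s \<le> R * t\<close> this forces \<open>s \<le> R\<^sup>2\<close>,
  hence \<open>R \<le> t\<close>.\<close>

lemma bisector_equation_iff:
  fixes R s t :: real
  assumes "R > 0" and "s \<le> R * t"
  shows "s \<le> R\<^sup>2 \<and> R \<le> t \<and> \<bar>s - R\<^sup>2\<bar> / R = t - R \<longleftrightarrow> t = \<bar>s - 2 * R\<^sup>2\<bar> / R"
proof
  assume L: "s \<le> R\<^sup>2 \<and> R \<le> t \<and> \<bar>s - R\<^sup>2\<bar> / R = t - R"
  then have "R\<^sup>2 - s = R * (t - R)"
    using assms(1) by (auto simp: divide_eq_eq mult.commute)
  then have "R * t = 2 * R\<^sup>2 - s"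
    by (simp add: algebra_simps power2_eq_square)
  moreover have "\<bar>s - 2 * R\<^sup>2\<bar> = 2 * R\<^sup>2 - s" using L zero_le_power2[of R] by linarith
  ultimately show "t = \<bar>s - 2 * R\<^sup>2\<bar> / R"
    using assms(1) by (simp add: field_simps)
next
  assume "t = \<bar>s - 2 * R\<^sup>2\<bar> / R"
  then have "R * t = \<bar>s - 2 * R\<^sup>2\<bar>" using assms(1) by simp
  moreover have "R\<^sup>2 > 0" using assms(1) by simp
  \<comment> \<open>If \<open>s\<close> exceeded \<open>2 * R\<^sup>2\<close>, then
    \<open>R * t = s - 2 * R\<^sup>2 < s\<close>, against the bound on \<open>s\<close>. So the
    absolute value is \<open>2 * R\<^sup>2 - s\<close>, and \<open>s \<le> R * t\<close> gives
    \<open>s \<le> R\<^sup>2\<close>.\<close>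
  ultimately have Rt: "R * t = 2 * R\<^sup>2 - s" and s: "s \<le> R\<^sup>2"
    using assms(2) by linarith+
  then have "R * R \<le> R * t" by (simp add: power2_eq_square)
  then have "R \<le> t" using assms(1) by simp
  with s Rt assms(1) show "s \<le> R\<^sup>2 \<and> R \<le> t \<and> \<bar>s - R\<^sup>2\<bar> / R = t - R"
    by (simp add: field_simps power2_eq_square)
qed

theorem theorem1:
  fixes c V :: point and R :: real and l :: "point set"
  assumes "R > 0"
    and "V \<in> sphere c R"
    and "tangent_line_at l (sphere c R) V"
  shows "(\<exists>!d. directrix_for c R V l d) \<and>
    (\<forall>d. directrix_for c R V l d \<longrightarrow>
      metric_bisector (horn_region c R l) l (sphere c R) = parabola c d)"
proof -
  let ?n = "V - c"
  let ?d = "{x. ?n \<bullet> x = ?n \<bullet> c + 2 * R\<^sup>2}"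
  have norm_n: "norm ?n = R"
    using assms(2) by (simp add: dist_norm norm_minus_commute)
  then have n: "?n \<noteq> 0" using assms(1) by auto
  have l: "l = {x. ?n \<bullet> x = ?n \<bullet> V}"
    by (rule tangent_line_eq_hyperplane[OF assms(1,3)])
  have directrix: "directrix_for c R V l d \<longleftrightarrow> d = ?d" for d
    by (subst l) (rule directrix_for_tangent_hyperplane_iff[OF assms(1) norm_n])
  have "?n \<bullet> ?n = R\<^sup>2" using norm_n by (simp only: dot_square_norm)
  then have nV: "?n \<bullet> V = ?n \<bullet> c + R\<^sup>2" by (simp only: inner_diff_right)
  have "metric_bisector (horn_region c R l) l (sphere c R) = parabola c ?d"
  proof (rule set_eqI)
    fix B
    let ?s = "?n \<bullet> (B - c)"
    have s: "?s \<le> R * dist c B"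
      using norm_cauchy_schwarz[of ?n "B - c"] norm_n by (simp add: dist_norm norm_minus_commute)
    \<comment> \<open>All levels of \<open>?n\<close> are measured from \<open>c\<close>, so both
      line distances depend only on \<open>?s\<close>.\<close>
    have nB: "?n \<bullet> B = ?n \<bullet> c + ?s" by (simp only: inner_diff_right)
    have dl: "infdist B l = \<bar>?s - R\<^sup>2\<bar> / R"
      by (subst l) (simp only: infdist_hyperplane[OF n] norm_n nV nB add_diff_cancel_left)
    have dd: "infdist B ?d = \<bar>?s - 2 * R\<^sup>2\<bar> / R"
      by (simp only: infdist_hyperplane[OF n] norm_n nB add_diff_cancel_left)
    \<comment> \<open>The formula for the distance to the circle holds only for
      \<open>R \<le> dist c B\<close>, a conjunct on both sides.\<close>
    have "B \<in> metric_bisector (horn_region c R l) l (sphere c R) \<longleftrightarrow>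
        ?s \<le> R\<^sup>2 \<and> R \<le> dist c B \<and> \<bar>?s - R\<^sup>2\<bar> / R = dist c B - R"
      unfolding metric_bisector_def horn_region_eq[OF assms(1,3)] nV nB mem_Collect_eq dl
        add_le_cancel_left
      using infdist_sphere_outside[OF assms(1)] by metis
    also have "\<dots> \<longleftrightarrow> dist c B = \<bar>?s - 2 * R\<^sup>2\<bar> / R"
      by (rule bisector_equation_iff[OF assms(1) s])
    also have "\<dots> \<longleftrightarrow> B \<in> parabola c ?d"
      unfolding parabola_def mem_Collect_eq dd by (simp add: dist_commute)
    finally show "B \<in> metric_bisector (horn_region c R l) l (sphere c R) \<longleftrightarrow> B \<in> parabola c ?d" .
  qed
  with directrix show ?thesis by simp
qed

end
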